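(* Let $p$ be an odd prime, $a\in\mathbb Z_p$ with $1\le\langle a\rangle_p<p/2$, and let $t=(a-\langle a\rangle_p)/p$ with $t\not\equiv 0\pmod p$. Then $$\sum_{k=0}^{p-1}\binom ak\binom{-1-a}k\frac p{k-a}\equiv\frac{2t+1}t(-1)^{\langle a\rangle_p-1}\binom{2\langle a\rangle_p}{\langle a\rangle_p}+2\binom{p-1-\langle a\rangle_p}{\langle a\rangle_p}\equiv(-1)^{\langle a\rangle_p-1}\binom{2\langle a\rangle_p}{\langle a\rangle_p}\Big(\frac1t+2p\big(H_{2\langle a\rangle_p}-H_{\langle a\rangle_p}\big)\Big)\pmod{p^2}.$$
   Context: $\mathbb Z_p$ denotes the set of rational numbers whose denominator is not divisible by $p$; congruences are taken in this ring. For $a\in\mathbb Z_p$, $\langle a\rangle_p\in\{0,1,\dots,p-1\}$ is defined by $a\equiv\langle a\rangle_p\pmod p$. $\binom xk=x(x-1)\cdots(x-k+1)/k!$ for rational $x$. $H_0=0$, $H_n=1+\frac12+\cdots+\frac1n$. *)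

theory Defs
  imports Complex_Main "HOL-Computational_Algebra.Primes"
begin

text \<open>\<^const>\<open>quotient_of\<close> returns the reduced fraction with positive denominator.\<close>

definition p_integers :: "nat \<Rightarrow> rat set" where
  "p_integers p = {x. \<not> int p dvd snd (quotient_of x)}"

text \<open>The congruence is one in the ring \<^term>\<open>p_integers p\<close>, so it includes the
  requirement that both sides belong to this ring.\<close>

definition p_cong :: "nat \<Rightarrow> rat \<Rightarrow> rat \<Rightarrow> nat \<Rightarrow> bool" where
  "p_cong p x y m \<longleftrightarrow> x \<in> p_integers p \<and> y \<in> p_integers p \<and>
     (\<exists>z \<in> p_integers p. x - y = of_nat m * z)"

definition p_residue :: "nat \<Rightarrow> rat \<Rightarrow> nat" where
  "p_residue p a = (THE r. r < p \<and> p_cong p a (of_nat r) p)"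

text \<open>The library's \<open>harm\<close> takes values in a \<^class>\<open>real_normed_field\<close>, which excludes
  the rationals.\<close>

definition harm_rat :: "nat \<Rightarrow> rat" where
  "harm_rat n = (\<Sum>k=1..n. 1 / of_nat k)"

end

theory Submission
  imports Defs
begin

text \<open>
  Write \<open>r\<close> for the residue of \<open>a\<close>, so \<open>a = r + p t\<close>. For \<open>k \<noteq> r\<close> the factor \<open>p / (k - a)\<close> is
  divisible by \<open>p\<close>, so modulo \<open>p\<^sup>2\<close> the binomials in the \<open>k\<close>-th term may be replaced by those of \<open>r\<close>;
  in particular the terms with \<open>k > r\<close> vanish. The replaced sum over \<open>k \<le> r\<close>, with the denominators
  \<open>k - a\<close> kept, is a partial fraction expansion with the exact value
  \<open>p (a+1)\<cdots>(a+r) / ((0-a)(1-a)\<cdots>(r-a))\<close>. This product, the term with \<open>k = r\<close> and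
  \<open>binomial(p-1-r, r)\<close> are all \<open>binomial(2r, r)\<close> times products of factors \<open>1 + p x / j\<close> and their
  inverses, which are expanded to first order in \<open>p\<close>.
\<close>

section \<open>Alternating binomial sums: finite differences and partial fractions\<close>

text \<open>Pascal's rule splits \<open>Suc n choose k\<close>, and reindexing one half pairs
  \<open>g k\<close> with \<open>- g (Suc k)\<close>. This peels one difference operator off an n-th
  difference and drives the inductions on \<open>n\<close> below.\<close>

lemma alternating_choose_sum_Suc:
  fixes g :: "nat \<Rightarrow> 'a::comm_ring_1"
  shows "(\<Sum>k\<le>Suc n. (-1) ^ k * of_nat (Suc n choose k) * g k)
       = (\<Sum>k\<le>n. (-1) ^ k * of_nat (n choose k) * (g k - g (Suc k)))"
proof -
  have "(\<Sum>k\<le>Suc n. (-1) ^ k * of_nat (Suc n choose k) * g k)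
      = g 0 + (\<Sum>k\<le>n. (-1) ^ Suc k * of_nat (n choose Suc k) * g (Suc k))
        + (\<Sum>k\<le>n. (-1) ^ Suc k * of_nat (n choose k) * g (Suc k))"
    by (subst sum.atMost_Suc_shift) (simp add: algebra_simps sum.distrib sum_negf sum_subtractf)
  also have "g 0 + (\<Sum>k\<le>n. (-1) ^ Suc k * of_nat (n choose Suc k) * g (Suc k))
      = (\<Sum>k\<le>Suc n. (-1) ^ k * of_nat (n choose k) * g k)"
    by (subst sum.atMost_Suc_shift) simp
  also have "\<dots> = (\<Sum>k\<le>n. (-1) ^ k * of_nat (n choose k) * g k)"
    by (simp add: binomial_eq_0)
  finally show ?thesis
    by (simp add: algebra_simps sum_negf sum_subtractf)
qed

text \<open>The \<open>n\<close>-th difference of a polynomial of degree \<open>m < n\<close> vanishes.\<close>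

lemma alternating_choose_sum_gbinomial:
  fixes c :: "'a::field_char_0"
  assumes "m < n"
  shows "(\<Sum>k\<le>n. (-1) ^ k * of_nat (n choose k) * ((c + of_nat k) gchoose m)) = 0"
  using assms
proof (induction n arbitrary: m)
  case (Suc n)
  \<comment> \<open>By Pascal's rule one difference lowers the degree of the binomial polynomial by
    one; the constant case \<open>m = 0\<close> gives zero.\<close>
  have diff: "((c + of_nat k) gchoose m) - ((c + of_nat (Suc k)) gchoose m)
      = (if m = 0 then 0 else - ((c + of_nat k) gchoose (m - 1)))" for k
    by (cases m) (use gbinomial_Suc_Suc[of "c + of_nat k"] in \<open>simp_all add: algebra_simps\<close>)
  show ?case
    unfolding alternating_choose_sum_Suc diff
    using Suc by (cases m) (simp_all add: sum_negf)
qed simp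

text \<open>This is the partial fraction expansion of n!/(c(c+1)...(c+n)). One difference of 1/(c+k)
  produces the same sum for \<open>c\<close> and for \<open>c + 1\<close>, so the induction must
  keep \<open>c\<close> arbitrary.\<close>

lemma alternating_choose_sum_inverse:
  fixes c :: "'a::field_char_0"
  assumes "\<And>k. k \<le> n \<Longrightarrow> c + of_nat k \<noteq> 0"
  shows "(\<Sum>k\<le>n. (-1) ^ k * of_nat (n choose k) * (1 / (c + of_nat k)))
       = fact n / pochhammer c (Suc n)"
  using assms
proof (induction n arbitrary: c)
  case (Suc n)
  have c0: "c \<noteq> 0" using Suc.prems[of 0] by simp
  have c1: "c + 1 + of_nat k \<noteq> 0" if "k \<le> n" for k
    using Suc.prems[of "Suc k"] that by (simp add: add_ac)
  have nz: "pochhammer (c + 1) n \<noteq> 0" "c + 1 + of_nat n \<noteq> 0"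
    using c1 by (auto simp: pochhammer_eq_0_iff eq_neg_iff_add_eq_0)
  have "(\<Sum>k\<le>Suc n. (-1) ^ k * of_nat (Suc n choose k) * (1 / (c + of_nat k)))
      = (\<Sum>k\<le>n. (-1) ^ k * of_nat (n choose k) * (1 / (c + of_nat k)))
        - (\<Sum>k\<le>n. (-1) ^ k * of_nat (n choose k) * (1 / ((c + 1) + of_nat k)))"
    unfolding alternating_choose_sum_Suc
    by (simp add: sum_subtractf right_diff_distrib add_ac)
  also have "(\<Sum>k\<le>n. (-1) ^ k * of_nat (n choose k) * (1 / (c + of_nat k)))
      = fact n / pochhammer c (Suc n)"
    using Suc.prems by (intro Suc.IH) auto
  also have "(\<Sum>k\<le>n. (-1) ^ k * of_nat (n choose k) * (1 / ((c + 1) + of_nat k)))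
      = fact n / pochhammer (c + 1) (Suc n)"
    using c1 by (intro Suc.IH)
  also have "fact n / pochhammer c (Suc n) - fact n / pochhammer (c + 1) (Suc n)
      = fact (Suc n) / pochhammer c (Suc (Suc n))"
  proof -
    \<comment> \<open>\<open>P\<close> is the common part (c+1)...(c+n): the two denominators are
      \<open>c * P\<close> and \<open>P * Z\<close>, and \<open>Z - c\<close> is n+1.\<close>
    define P where "P = pochhammer (c + 1) n"
    define Z where "Z = c + 1 + of_nat n"
    have "fact n / (c * P) - fact n / (P * Z) = fact n * (Z - c) / (c * (P * Z))"
      using nz c0 unfolding P_def[symmetric] Z_def[symmetric] by (simp add: field_simps)
    also have "fact n * (Z - c) = fact (Suc n)"
      by (simp add: Z_def algebra_simps)
    finally show ?thesis
      by (simp only: P_def Z_def pochhammer_rec[of c] pochhammer_Suc[of "c + 1"])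
  qed
  finally show ?case .
qed simp

text \<open>Replacing k by the pole -c in the numerator changes each quotient by a polynomial in k
  of degree below \<open>n\<close>, which the n-th difference kills. Only the numerator's value at
  the pole survives. The induction on \<open>m\<close> carries this out one linear factor at a
  time.\<close>

lemma alternating_choose_sum_gbinomial_inverse:
  fixes c :: "'a::field_char_0"
  assumes "\<And>k. k \<le> n \<Longrightarrow> c + of_nat k \<noteq> 0" and "m \<le> n"
  shows "(\<Sum>k\<le>n. (-1) ^ k * of_nat (n choose k) * ((of_nat m + of_nat k) gchoose m) / (c + of_nat k))
       = ((of_nat m - c) gchoose m) * (fact n / pochhammer c (Suc n))"
  using assms(2)
proof (induction m)
  case 0
  then show ?case using alternating_choose_sum_inverse[OF assms(1)] by simp
next
  case (Suc m)
  have absorb: "of_nat (Suc m) * ((of_nat (Suc m) + x) gchoose Suc m)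
      = (of_nat (Suc m) + x) * ((of_nat m + x) gchoose m)" for x :: 'a
    using gbinomial_absorption[of m "of_nat (Suc m) + x"] by (simp add: add_ac)
  have "of_nat (Suc m) * (\<Sum>k\<le>n. (-1) ^ k * of_nat (n choose k)
          * ((of_nat (Suc m) + of_nat k) gchoose Suc m) / (c + of_nat k))
      = (\<Sum>k\<le>n. (-1) ^ k * of_nat (n choose k)
          * (of_nat (Suc m) * ((of_nat (Suc m) + of_nat k) gchoose Suc m)) / (c + of_nat k))"
    by (simp add: sum_distrib_left mult_ac)
  \<comment> \<open>The new factor is split as (m+1+k) = (c+k) + (m+1-c). The first part cancels the
    denominator and leaves a sum that vanishes because m < n.\<close>
  also have "\<dots> = (\<Sum>k\<le>n. (-1) ^ k * of_nat (n choose k) * ((of_nat m + of_nat k) gchoose m)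
        + (of_nat (Suc m) - c) * ((-1) ^ k * of_nat (n choose k)
            * ((of_nat m + of_nat k) gchoose m) / (c + of_nat k)))"
    unfolding absorb by (intro sum.cong refl) (use assms(1) in \<open>simp add: field_simps\<close>)
  also have "\<dots> = (of_nat (Suc m) - c) * (((of_nat m - c) gchoose m) * (fact n / pochhammer c (Suc n)))"
    using Suc.IH Suc.prems alternating_choose_sum_gbinomial[of m n "of_nat m"]
    unfolding sum.distrib sum_distrib_left[symmetric] by simp
  also have "\<dots> = of_nat (Suc m) * (((of_nat (Suc m) - c) gchoose Suc m)
      * (fact n / pochhammer c (Suc n)))"
    using absorb[of "-c"] by (simp add: mult.assoc[symmetric] del: of_nat_Suc)
  finally show ?case
    unfolding mult_cancel_left by (simp del: of_nat_Suc)
qed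

text \<open>Each factor y+(m+j) is divided by its value at y = 0. For \<open>y\<close> a multiple of
  p the remaining factors are close to 1 and can be expanded.\<close>

lemma pochhammer_add_Suc:
  fixes y :: "'a::field_char_0"
  shows "pochhammer (y + 1 + of_nat m) n
       = pochhammer (1 + of_nat m) n * (\<Prod>j=1..n. 1 + y / of_nat (m + j))"
proof (induction n)
  case (Suc n)
  have "(of_nat (m + Suc n) :: 'a) \<noteq> 0" by (simp del: of_nat_Suc)
  then have "y + of_nat (m + Suc n) = of_nat (m + Suc n) * (1 + y / of_nat (m + Suc n))"
    by (simp add: field_simps del: of_nat_Suc)
  then show ?case
    using Suc unfolding pochhammer_Suc
    by (simp add: add_ac mult_ac)
qed simp

lemma harm_rat_diff: "harm_rat (m + n) - harm_rat m = (\<Sum>j=1..n. 1 / of_nat (m + j))"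
  by (induction n) (simp_all add: harm_rat_def algebra_simps)

section \<open>The ring of p-integers\<close>

context
  fixes p :: nat
  assumes p: "prime p"
begin

text \<open>Any fraction with denominator prime to p will do, not only the reduced one, so closure
  properties need no reduction. If p divided the reduced denominator, cross-multiplication would
  make it divide the reduced numerator too.\<close>

lemma p_integers_iff: "x \<in> p_integers p \<longleftrightarrow> (\<exists>n d. x = of_int n / of_int d \<and> \<not> int p dvd d)"
proof
  assume "x \<in> p_integers p"
  then show "\<exists>n d. x = of_int n / of_int d \<and> \<not> int p dvd d"
    unfolding p_integers_def by (metis mem_Collect_eq prod.collapse quotient_of_div)
next
  assume "\<exists>n d. x = of_int n / of_int d \<and> \<not> int p dvd d"
  then obtain n d where nd: "x = of_int n / of_int d" "\<not> int p dvd d" by blast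
  obtain n' d' where q: "quotient_of x = (n', d')" by fastforce
  have d: "d \<noteq> 0" "d' > 0" using nd(2) quotient_of_denom_pos[OF q] by auto
  have "of_int n / of_int d = (of_int n' / of_int d' :: rat)"
    using quotient_of_div[OF q] nd(1) by simp
  then have "of_int (n * d') = (of_int (n' * d) :: rat)"
    using d by (simp add: field_simps)
  then have eq: "n * d' = n' * d" using of_int_eq_iff by blast
  have "\<not> int p dvd d'"
  proof
    assume dvd: "int p dvd d'"
    then have "int p dvd n' * d" by (simp flip: eq)
    then have "int p dvd n'" using p nd(2) by (simp add: prime_dvd_mult_iff)
    with dvd quotient_of_coprime[OF q] have "is_unit (int p)"
      by (meson coprime_common_divisor)
    then show False using p by simp
  qed
  then show "x \<in> p_integers p" by (simp add: p_integers_def q)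
qed

lemma p_integers_of_int [simp]: "of_int n \<in> p_integers p"
  unfolding p_integers_iff using p by (rule_tac exI[of _ n], rule_tac exI[of _ 1]) (auto simp: not_prime_1)

lemma p_integers_of_nat [simp]: "of_nat n \<in> p_integers p"
  using p_integers_of_int[of "int n"] by simp

lemma p_integers_numeral [simp]:
  "0 \<in> p_integers p" "1 \<in> p_integers p" "numeral w \<in> p_integers p"
  using p_integers_of_int[of 0] p_integers_of_int[of 1] p_integers_of_int[of "numeral w"] by simp_all

lemma p_integers_add [simp]:
  assumes "x \<in> p_integers p" "y \<in> p_integers p"
  shows "x + y \<in> p_integers p"
proof -
  obtain n d n' d' where *: "x = of_int n / of_int d" "\<not> int p dvd d"
      "y = of_int n' / of_int d'" "\<not> int p dvd d'"
    using assms unfolding p_integers_iff by blast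
  then have "d \<noteq> 0" "d' \<noteq> 0" by auto
  then have "x + y = of_int (n * d' + n' * d) / of_int (d * d')"
    using * by (simp add: field_simps)
  moreover have "\<not> int p dvd d * d'" using * p by (simp add: prime_dvd_mult_iff)
  ultimately show ?thesis unfolding p_integers_iff by blast
qed

lemma p_integers_mult [simp]:
  assumes "x \<in> p_integers p" "y \<in> p_integers p"
  shows "x * y \<in> p_integers p"
proof -
  obtain n d n' d' where *: "x = of_int n / of_int d" "\<not> int p dvd d"
      "y = of_int n' / of_int d'" "\<not> int p dvd d'"
    using assms unfolding p_integers_iff by blast
  then have "x * y = of_int (n * n') / of_int (d * d')" by simp
  moreover have "\<not> int p dvd d * d'" using * p by (simp add: prime_dvd_mult_iff)
  ultimately show ?thesis unfolding p_integers_iff by blast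
qed

lemma p_integers_uminus [simp]: "x \<in> p_integers p \<Longrightarrow> - x \<in> p_integers p"
  using p_integers_mult[OF p_integers_of_int[of "-1"]] by simp

lemma p_integers_diff [simp]: "x \<in> p_integers p \<Longrightarrow> y \<in> p_integers p \<Longrightarrow> x - y \<in> p_integers p"
  using p_integers_add[of x "-y"] by simp

lemma p_integers_power [simp]: "x \<in> p_integers p \<Longrightarrow> x ^ n \<in> p_integers p"
  by (induction n) auto

lemma p_integers_sum: "(\<And>i. i \<in> A \<Longrightarrow> f i \<in> p_integers p) \<Longrightarrow> sum f A \<in> p_integers p"
  by (induction A rule: infinite_finite_induct) auto

text \<open>The ring is local with maximal ideal generated by p: a numerator divisible by p would
  make \<open>x\<close> a multiple of p, so the fraction can be inverted.\<close>

lemma p_integers_inverse: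
  assumes "x \<in> p_integers p" "\<not> p_cong p x 0 p"
  shows "1 / x \<in> p_integers p"
proof -
  obtain n d where *: "x = of_int n / of_int d" "\<not> int p dvd d"
    using assms unfolding p_integers_iff by blast
  have "\<not> int p dvd n"
  proof
    assume "int p dvd n"
    then obtain m where "n = int p * m" ..
    then have "x - 0 = of_nat p * (of_int m / of_int d)" using * by simp
    moreover have "of_int m / of_int d \<in> p_integers p" using * p_integers_iff by blast
    ultimately show False using assms unfolding p_cong_def by auto
  qed
  then show ?thesis unfolding p_integers_iff * by (rule_tac exI[of _ d], rule_tac exI[of _ n]) simp
qed

lemma p_integers_1_div_of_nat:
  assumes "0 < j" "j < p"
  shows "1 / of_nat j \<in> p_integers p"
  unfolding p_integers_iff using assms
  by (rule_tac exI[of _ 1], rule_tac exI[of _ "int j"]) (simp add: nat_dvd_not_less)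

lemma p_integers_1_div_fact:
  assumes "n < p"
  shows "1 / fact n \<in> p_integers p"
  unfolding p_integers_iff using assms p prime_dvd_fact_iff[of p n]
  by (rule_tac exI[of _ 1], rule_tac exI[of _ "int (fact n)"]) (simp del: of_nat_fact, simp)

lemma p_integers_1_div_one_plus:
  assumes "z \<in> p_integers p"
  shows "1 / (1 + of_nat p * z) \<in> p_integers p"
proof -
  obtain n d where *: "z = of_int n / of_int d" "\<not> int p dvd d"
    using assms unfolding p_integers_iff by blast
  then have "d \<noteq> 0" by auto
  then have "1 + of_nat p * z = of_int (d + int p * n) / of_int d"
    using * by (simp add: field_simps)
  then have "1 / (1 + of_nat p * z) = of_int d / of_int (d + int p * n)"
    by simp
  moreover have "\<not> int p dvd d + int p * n" using *(2) by (simp add: dvd_add_left_iff)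
  ultimately show ?thesis unfolding p_integers_iff by blast
qed

section \<open>Calculus of congruences and residues\<close>

lemma p_congI:
  "\<lbrakk>y \<in> p_integers p; z \<in> p_integers p; x = y + of_nat m * z\<rbrakk> \<Longrightarrow> p_cong p x y m"
  unfolding p_cong_def by auto

lemma p_congE:
  assumes "p_cong p x y m"
  obtains z where "x \<in> p_integers p" "y \<in> p_integers p" "z \<in> p_integers p" "x = y + of_nat m * z"
  using assms unfolding p_cong_def by (metis diff_add_cancel add.commute)

lemma p_cong_refl: "x \<in> p_integers p \<Longrightarrow> p_cong p x x m"
  by (rule p_congI[of _ 0]) auto

lemma p_cong_sym: "p_cong p x y m \<Longrightarrow> p_cong p y x m"
  by (erule p_congE, rule p_congI[of _ "- z" for z]) auto

lemma p_cong_trans: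
  assumes "p_cong p x y m" "p_cong p y z m"
  shows "p_cong p x z m"
proof -
  obtain u v where "z \<in> p_integers p" "u \<in> p_integers p" "v \<in> p_integers p"
    "x = y + of_nat m * u" "y = z + of_nat m * v"
    using assms by (metis p_congE)
  then show ?thesis by (intro p_congI[of _ "u + v"]) (auto simp: algebra_simps)
qed

lemma p_cong_add:
  assumes "p_cong p x y m" "p_cong p x' y' m"
  shows "p_cong p (x + x') (y + y') m"
proof -
  obtain u v where "y \<in> p_integers p" "y' \<in> p_integers p" "u \<in> p_integers p" "v \<in> p_integers p"
    "x = y + of_nat m * u" "x' = y' + of_nat m * v"
    using assms by (metis p_congE)
  then show ?thesis by (intro p_congI[of _ "u + v"]) (auto simp: algebra_simps)
qed

lemma p_cong_mult:
  assumes "p_cong p x y m" "p_cong p x' y' m"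
  shows "p_cong p (x * x') (y * y') m"
proof -
  obtain u v where "y \<in> p_integers p" "y' \<in> p_integers p" "u \<in> p_integers p" "v \<in> p_integers p"
    "x = y + of_nat m * u" "x' = y' + of_nat m * v"
    using assms by (metis p_congE)
  then show ?thesis
    by (intro p_congI[of _ "y * v + y' * u + of_nat m * u * v"]) (auto simp: algebra_simps)
qed

lemma p_cong_sum: "(\<And>i. i \<in> A \<Longrightarrow> p_cong p (f i) (g i) m) \<Longrightarrow> p_cong p (sum f A) (sum g A) m"
  by (induction A rule: infinite_finite_induct) (auto intro: p_cong_add p_cong_refl)

lemma p_cong_prod: "(\<And>i. i \<in> A \<Longrightarrow> p_cong p (f i) (g i) m) \<Longrightarrow> p_cong p (prod f A) (prod g A) m"
  by (induction A rule: infinite_finite_induct) (auto intro: p_cong_mult p_cong_refl)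

text \<open>A factor p upgrades a congruence modulo p to one modulo \<open>p\<^sup>2\<close>; this
  is what permits replacing \<open>a\<close> by its residue in the terms with k different from
  r.\<close>

lemma p_cong_mult_p:
  assumes "p_cong p x y p" "z \<in> p_integers p"
  shows "p_cong p (x * (of_nat p * z)) (y * (of_nat p * z)) (p\<^sup>2)"
proof -
  obtain u where "y \<in> p_integers p" "u \<in> p_integers p" "x = y + of_nat p * u"
    using assms by (metis p_congE)
  with assms show ?thesis
    by (intro p_congI[of _ "u * z"]) (auto simp: algebra_simps power2_eq_square)
qed

text \<open>The bound \<open>k < p\<close> makes k! a unit, so the falling factorials can be
  compared factor by factor.\<close>

lemma p_cong_gbinomial:
  assumes "p_cong p x y p" "k < p"
  shows "p_cong p (x gchoose k) (y gchoose k) p"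
proof -
  have "p_cong p (x - of_nat i) (y - of_nat i) p" for i
    using p_cong_add[OF assms(1) p_cong_refl[of "- of_nat i"]] by simp
  then have "p_cong p ((\<Prod>i=0..<k. x - of_nat i) * (1 / fact k))
      ((\<Prod>i=0..<k. y - of_nat i) * (1 / fact k)) p"
    using assms(2) by (intro p_cong_mult p_cong_prod p_cong_refl p_integers_1_div_fact)
  then show ?thesis by (simp add: gbinomial_prod_rev)
qed

lemma p_cong_of_nat_eq:
  assumes "p_cong p (of_nat i) (of_nat j) p" "i < p" "j < p"
  shows "i = j"
proof -
  obtain z where z: "z \<in> p_integers p" "of_nat i = of_nat j + of_nat p * z"
    using assms(1) by (rule p_congE)
  obtain n d where nd: "z = of_int n / of_int d" "\<not> int p dvd d"
    using z(1) unfolding p_integers_iff by blast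
  then have "d \<noteq> 0" by auto
  then have "(of_int ((int i - int j) * d) :: rat) = of_int (int p * n)"
    using z(2) nd(1) by (simp add: field_simps)
  then have "(int i - int j) * d = int p * n" using of_int_eq_iff by blast
  then have "int p dvd (int i - int j) * d" by simp
  then have "int p dvd int i - int j" using p nd(2) by (simp add: prime_dvd_mult_iff)
  then have "int i mod int p = int j mod int p" by (simp add: mod_eq_dvd_iff)
  then show ?thesis using assms(2,3) by simp
qed

text \<open>The definite description in \<open>p_residue\<close> is usable only after existence and
  uniqueness are known. Existence comes from Bezout, uniqueness from
  \<open>p_cong_of_nat_eq\<close>.\<close>

lemma p_residue_works:
  assumes "x \<in> p_integers p"
  shows "p_residue p x < p" "p_cong p x (of_nat (p_residue p x)) p"
proof -
  obtain n d where nd: "x = of_int n / of_int d" "\<not> int p dvd d"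
    using assms unfolding p_integers_iff by blast
  then have d: "d \<noteq> 0" by auto
  have "coprime (int p) d" using p nd(2) by (simp add: prime_imp_coprime)
  then obtain u v where uv: "u * int p + v * d = 1"
    by (metis bezout_int coprime_imp_gcd_eq_1)
  \<comment> \<open>Here \<open>v\<close> inverts the denominator \<open>d\<close> modulo p, so n*v
    represents n/d.\<close>
  define q where "q = n * v mod int p"
  have q: "0 \<le> q" "q < int p" using p by (simp_all add: q_def prime_gt_0_nat)
  have "n = (n * u) * int p + (n * v) * d" using uv by (metis distrib_left mult.assoc mult.right_neutral)
  also have "n * v = int p * (n * v div int p) + q" by (simp add: q_def)
  finally have "n = q * d + int p * (n * u + (n * v div int p) * d)" by (simp add: algebra_simps)
  then obtain w where w: "n = q * d + int p * w" by blast
  have "p_cong p x (of_nat (nat q)) p"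
  proof (rule p_congI)
    show "of_int w / of_int d \<in> p_integers p" using nd(2) p_integers_iff by blast
    show "x = of_nat (nat q) + of_nat p * (of_int w / of_int d)"
      using d q(1) by (simp add: nd(1) w field_simps)
  qed simp
  moreover have "nat q < p" using q by linarith
  ultimately have "\<exists>!i. i < p \<and> p_cong p x (of_nat i) p"
    by (metis p_cong_of_nat_eq p_cong_sym p_cong_trans)
  then have "p_residue p x < p \<and> p_cong p x (of_nat (p_residue p x)) p"
    unfolding p_residue_def by (rule theI')
  then show "p_residue p x < p" "p_cong p x (of_nat (p_residue p x)) p" by auto
qed

section \<open>First-order expansion of products\<close>

text \<open>All cross terms carry \<open>p\<^sup>2\<close>. The factors \<open>F j\<close> need only
  be congruent to 1 + p f(j), so that inverses of such factors are covered as well.\<close>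

lemma p_cong_prod_one_plus:
  assumes "\<And>j. j \<in> A \<Longrightarrow> p_cong p (F j) (1 + of_nat p * f j) (p\<^sup>2)"
    and "\<And>j. j \<in> A \<Longrightarrow> f j \<in> p_integers p"
  shows "p_cong p (prod F A) (1 + of_nat p * sum f A) (p\<^sup>2)"
  using assms
proof (induction A rule: infinite_finite_induct)
  case (insert j A)
  have s: "sum f A \<in> p_integers p" using insert.prems(2) by (intro p_integers_sum) auto
  have f: "f j \<in> p_integers p" using insert.prems(2) by auto
  have "p_cong p (F j * prod F A) ((1 + of_nat p * f j) * (1 + of_nat p * sum f A)) (p\<^sup>2)"
    using insert by (intro p_cong_mult) auto
  moreover have "p_cong p ((1 + of_nat p * f j) * (1 + of_nat p * sum f A))
      (1 + of_nat p * (f j + sum f A)) (p\<^sup>2)"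
    using s f by (intro p_congI[of _ "f j * sum f A"]) (auto simp: algebra_simps power2_eq_square)
  ultimately have "p_cong p (F j * prod F A) (1 + of_nat p * (f j + sum f A)) (p\<^sup>2)"
    by (rule p_cong_trans)
  then show ?case by (simp only: insert.hyps prod.insert sum.insert not_False_eq_True)
qed (simp_all add: p_cong_refl)

text \<open>With w = pz this is the exact identity 1/(1+w) = 1 - w + w^2/(1+w), whose last term is
  \<open>p\<^sup>2\<close> times a p-integer.\<close>

lemma p_cong_1_div_one_plus:
  assumes "z \<in> p_integers p"
  shows "p_cong p (1 / (1 + of_nat p * z)) (1 + of_nat p * (- z)) (p\<^sup>2)"
proof (rule p_congI)
  show "z\<^sup>2 * (1 / (1 + of_nat p * z)) \<in> p_integers p"
    by (intro p_integers_mult p_integers_power p_integers_1_div_one_plus assms)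
  have "1 + of_nat p * z \<noteq> 0"
  proof
    assume "1 + of_nat p * z = 0"
    then have "p_cong p (of_nat 1) (of_nat 0) p"
      using assms by (intro p_congI[of _ "-z"]) (auto simp: add_eq_0_iff2)
    then show False using p_cong_of_nat_eq[of 1 0] prime_gt_1_nat[OF p] by simp
  qed
  then show "1 / (1 + of_nat p * z)
      = 1 + of_nat p * (- z) + of_nat (p\<^sup>2) * (z\<^sup>2 * (1 / (1 + of_nat p * z)))"
    by (simp add: field_simps power2_eq_square)
qed (use assms in simp)

lemma p_cong_prod_one_plus_divide:
  assumes "x \<in> p_integers p" "\<And>j. j \<in> A \<Longrightarrow> 1 / m j \<in> p_integers p"
  shows "p_cong p (\<Prod>j\<in>A. 1 + of_nat p * x / m j) (1 + of_nat p * (x * (\<Sum>j\<in>A. 1 / m j))) (p\<^sup>2)"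
proof -
  have x: "x * (1 / m j) \<in> p_integers p" if "j \<in> A" for j
    by (intro p_integers_mult assms that)
  have "p_cong p (\<Prod>j\<in>A. 1 + of_nat p * (x * (1 / m j)))
      (1 + of_nat p * (\<Sum>j\<in>A. x * (1 / m j))) (p\<^sup>2)"
    by (intro p_cong_prod_one_plus p_cong_refl x p_integers_add p_integers_mult) auto
  then show ?thesis unfolding sum_distrib_left[symmetric] by simp
qed

lemma p_cong_1_div_prod_one_plus_divide:
  assumes "x \<in> p_integers p" "\<And>j. j \<in> A \<Longrightarrow> 1 / m j \<in> p_integers p"
  shows "p_cong p (1 / (\<Prod>j\<in>A. 1 + of_nat p * x / m j))
    (1 + of_nat p * (- x * (\<Sum>j\<in>A. 1 / m j))) (p\<^sup>2)"
proof -
  have x: "x * (1 / m j) \<in> p_integers p" if "j \<in> A" for j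
    by (intro p_integers_mult assms that)
  have "p_cong p (\<Prod>j\<in>A. 1 / (1 + of_nat p * (x * (1 / m j))))
      (1 + of_nat p * (\<Sum>j\<in>A. - (x * (1 / m j)))) (p\<^sup>2)"
    by (intro p_cong_prod_one_plus p_cong_1_div_one_plus x p_integers_uminus)
  then show ?thesis
    unfolding sum_negf sum_distrib_left[symmetric] prod_dividef prod.neutral_const by simp
qed

end

theorem theorem3p1:
  fixes p r :: nat and a t :: rat
  assumes "prime p" and "odd p"
    and "a \<in> p_integers p"
    and "r = p_residue p a"
    and "1 \<le> r" and "real r < real p / 2"
    and "t = (a - of_nat r) / of_nat p"
    and "\<not> p_cong p t 0 p"
  shows
    "p_cong p
       (\<Sum>k=0..p-1. (a gchoose k) * ((-1 - a) gchoose k) * (of_nat p / (of_nat k - a)))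
       ((2 * t + 1) / t * (-1) ^ (r - 1) * of_nat ((2 * r) choose r)
          + 2 * of_nat ((p - 1 - r) choose r))
       (p\<^sup>2)
     \<and> p_cong p
       ((2 * t + 1) / t * (-1) ^ (r - 1) * of_nat ((2 * r) choose r)
          + 2 * of_nat ((p - 1 - r) choose r))
       ((-1) ^ (r - 1) * of_nat ((2 * r) choose r)
          * (1 / t + 2 * of_nat p * (harm_rat (2 * r) - harm_rat r)))
       (p\<^sup>2)"
proof -
  note p = assms(1)
  note [simp] = p_integers_of_int[OF p] p_integers_of_nat[OF p] p_integers_numeral[OF p]
    p_integers_add[OF p] p_integers_mult[OF p] p_integers_uminus[OF p] p_integers_diff[OF p]
    p_integers_power[OF p]
  note trans = p_cong_trans[OF p] and refl = p_cong_refl[OF p]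
  have r2p: "2 * r < p" using assms(6) by linarith
  have p0: "p > 0" "(of_nat p :: rat) \<noteq> 0" using p by (auto simp: prime_gt_0_nat)
  have a: "a = of_nat r + of_nat p * t" using p0 assms(7) by simp
  have ar: "p_cong p a (of_nat r) p" using p_residue_works(2)[OF p assms(3)] assms(4) by simp
  have t: "t \<in> p_integers p"
    using ar p0 a by (auto elim!: p_congE[OF p])
  have t0: "t \<noteq> 0" using assms(8) refl[of 0 p] by auto
  have invt: "1 / t \<in> p_integers p" using p_integers_inverse[OF p t assms(8)] .

  \<comment> \<open>Normalised products and their expansions at y = a - r\<close>
  define y where "y = of_nat p * t"
  define B :: rat where "B = of_nat ((2 * r) choose r)"
  define s :: rat where "s = (-1) ^ (r - 1)"
  \<comment> \<open>This requires r >= 1, since \<open>r - 1\<close> is truncated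
    subtraction.\<close>
  have s: "(-1) ^ r = - s" using assms(5) by (cases r) (simp_all add: s_def)
  have [simp]: "s \<in> p_integers p" "B \<in> p_integers p" by (simp_all add: s_def B_def)
  define H1 :: rat where "H1 = (\<Sum>j=1..r. 1 / of_nat j)"
  define H2 :: rat where "H2 = (\<Sum>j=1..r. 1 / of_nat (r + j))"
  have harm: "harm_rat (2 * r) - harm_rat r = H2"
    using harm_rat_diff[of r r] by (simp add: H2_def mult_2)
  \<comment> \<open>Here r < p/2 enters: every denominator up to 2r is prime to p.\<close>
  have inv [simp]: "1 / of_nat j \<in> p_integers p" if "1 \<le> j" "j \<le> 2 * r" for j
    using that r2p by (intro p_integers_1_div_of_nat[OF p]) auto
  have H [simp]: "H1 \<in> p_integers p" "H2 \<in> p_integers p"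
    unfolding H1_def H2_def by (auto intro!: p_integers_sum[OF p] inv simp del: of_nat_add)

  \<comment> \<open>\<open>D x\<close> and \<open>E x\<close> are (x+1)...(x+r) and
    (x+r+1)...(x+2r), each divided by its value at x = 0.\<close>
  define D where "D x = (\<Prod>j=1..r. 1 + x / of_nat j)" for x :: rat
  define E where "E x = (\<Prod>j=1..r. 1 + x / of_nat (r + j))" for x :: rat
  have poch1: "pochhammer (x + 1) r = fact r * D x" for x
    using pochhammer_add_Suc[of x 0 r] by (simp add: D_def pochhammer_fact)
  have B_poch: "B * fact r = pochhammer (1 + of_nat r) r"
    using gbinomial_pochhammer'[of "of_nat (2 * r) :: rat" r]
    by (simp add: B_def binomial_gbinomial add_ac)
  have poch2: "pochhammer (x + 1 + of_nat r) r = B * fact r * E x" for x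
    unfolding E_def pochhammer_add_Suc B_poch by simp
  have E_cong: "p_cong p (E (of_nat p * x)) (1 + of_nat p * (x * H2)) (p\<^sup>2)"
    if "x \<in> p_integers p" for x
    unfolding E_def H2_def using that
    by (intro p_cong_prod_one_plus_divide[OF p] inv) auto
  have D_cong: "p_cong p (D y) (1 + of_nat p * (t * H1)) (p\<^sup>2)"
    unfolding D_def H1_def y_def using t
    by (intro p_cong_prod_one_plus_divide[OF p] inv) auto
  have D'_cong: "p_cong p (1 / D y) (1 + of_nat p * (- t * H1)) (p\<^sup>2)"
    unfolding D_def H1_def y_def using t
    by (intro p_cong_1_div_prod_one_plus_divide[OF p] inv) auto

  \<comment> \<open>Reduction of the terms with k different from r\<close>
  have nz: "of_nat k - a \<noteq> 0" if "k < p" for k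
  proof
    assume "of_nat k - a = 0"
    then have ka: "a = of_nat k" by simp
    then have "k = r" using ar that r2p p_cong_of_nat_eq[OF p, of k r] by simp
    then show False using ka a t0 p0 by simp
  qed
  have unit: "1 / (of_nat k - a) \<in> p_integers p" if "k < p" "k \<noteq> r" for k
  proof (rule p_integers_inverse[OF p])
    show "of_nat k - a \<in> p_integers p" using assms(3) by simp
    show "\<not> p_cong p (of_nat k - a) 0 p"
    proof
      assume "p_cong p (of_nat k - a) 0 p"
      from p_cong_add[OF p this ar] have "p_cong p (of_nat k) (of_nat r) p" by simp
      then show False using that r2p p_cong_of_nat_eq[OF p, of k r] by simp
    qed
  qed

  define T where "T k = (a gchoose k) * ((-1 - a) gchoose k) * (of_nat p / (of_nat k - a))" for k
  define U :: "nat \<Rightarrow> rat"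
    where "U k = (of_nat r gchoose k) * ((-1 - of_nat r) gchoose k)" for k
  have TU: "p_cong p (T k) (U k * (of_nat p / (of_nat k - a))) (p\<^sup>2)" if "k < p" "k \<noteq> r" for k
  proof -
    have "p_cong p (-1 - a) (-1 - of_nat r) p"
      using p_cong_add[OF p refl[of "-1"] p_cong_mult[OF p refl[of "-1"] ar]] by simp
    then have "p_cong p ((a gchoose k) * ((-1 - a) gchoose k)) (U k) p"
      unfolding U_def using that ar by (intro p_cong_mult[OF p] p_cong_gbinomial[OF p])
    from p_cong_mult_p[OF p this unit[OF that]] show ?thesis by (simp add: T_def)
  qed
  have U_large: "U k = 0" if "r < k" for k
    using that by (simp add: U_def binomial_eq_0 flip: binomial_gbinomial)
  \<comment> \<open>Upper negation followed by symmetry turns the second binomial into a polynomial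
    in k of fixed degree r, the shape required by the partial fraction lemma.\<close>
  have U: "U k = (-1) ^ k * of_nat (r choose k) * ((of_nat r + of_nat k) gchoose r)" for k
  proof -
    have "(-1 - of_nat r :: rat) gchoose k = (-1) ^ k * ((of_nat r + of_nat k) gchoose k)"
      using gbinomial_minus[of "1 + of_nat r :: rat" k] by (simp add: add_ac)
    also have "((of_nat r + of_nat k :: rat) gchoose k) = (of_nat r + of_nat k) gchoose r"
      using binomial_symmetric[of k "r + k"] by (simp flip: binomial_gbinomial of_nat_add)
    finally show ?thesis by (simp add: U_def binomial_gbinomial)
  qed
  have Ur: "U r = - (s * B)"
    using binomial_gbinomial[of "2 * r" r, where 'a = rat] unfolding U s B_def by simp
  have pa: "of_nat p / (of_nat r - a) = - (1 / t)"
    using t0 p0 by (simp add: a)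

  \<comment> \<open>Exact values of the term k = r and of the replaced sum\<close>
  \<comment> \<open>Since p/(r-a) = -1/t carries no factor p, the binomials of \<open>a\<close>
    itself are kept here. Their factors are y+1,...,y+r and, up to sign, y+r+1,...,y+2r.\<close>
  have Tr: "T r = s * B * (D y * E y) * (1 / t)"
  proof -
    have "a gchoose r = D y"
      using poch1[of y] by (simp add: gbinomial_pochhammer' a y_def)
    moreover have "(-1 - a) gchoose r = - s * B * E y"
      using poch2[of y] by (simp add: gbinomial_pochhammer a y_def s add_ac)
    ultimately show ?thesis by (simp add: T_def pa)
  qed

  have R: "(\<Sum>k\<le>r. U k * (of_nat p / (of_nat k - a))) = s * B * (E y * (1 / D y)) * (1 / t)"
  proof -
    have "(\<Sum>k\<le>r. U k * (of_nat p / (of_nat k - a)))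
        = of_nat p * (\<Sum>k\<le>r. (-1) ^ k * of_nat (r choose k) * ((of_nat r + of_nat k) gchoose r) / (- a + of_nat k))"
      unfolding sum_distrib_left U by (simp add: mult_ac)
    \<comment> \<open>Partial fractions with c = -a and m = n = r.\<close>
    also have "\<dots> = of_nat p * (((of_nat r + a) gchoose r) * (fact r / pochhammer (- a) (Suc r)))"
      using nz r2p by (subst alternating_choose_sum_gbinomial_inverse) auto
    also have "((of_nat r + a) gchoose r) = B * E y"
      using poch2[of y] by (simp add: gbinomial_pochhammer' a y_def add_ac)
    \<comment> \<open>Up to sign the factors are y+r,...,y+1,y, and the sign (-1)^(r+1) is
      \<open>s\<close>. The lone factor \<open>y\<close> = pt later cancels the p in front.\<close>
    also have "pochhammer (- a) (Suc r) = s * y * (fact r * D y)"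
      unfolding pochhammer_minus using poch1[of y]
      by (simp add: pochhammer_rec a y_def s)
    also have "of_nat p * (B * E y * (fact r / (s * y * (fact r * D y))))
        = s * B * (E y * (1 / D y)) * (1 / t)"
    proof -
      have "s * s = 1" "s \<noteq> 0" by (simp_all add: s_def flip: power_mult_distrib)
      then have "1 / s = s" by (simp add: divide_eq_eq)
      moreover have "of_nat p * (B * E y * (fact r / (s * y * (fact r * D y))))
          = 1 / s * B * (E y * (1 / D y)) * (1 / t)"
        using p0 by (simp add: y_def)
      ultimately show ?thesis by simp
    qed
    finally show ?thesis .
  qed

  \<comment> \<open>Assembly of the sum modulo \<open>p\<^sup>2\<close>\<close>
  have split: "(\<Sum>k=0..p-1. f k) = f r + (\<Sum>k\<in>{0..p-1}-{r}. f k)" for f :: "nat \<Rightarrow> rat"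
    using r2p by (subst sum.remove[of _ r]) auto
  have "(\<Sum>k=0..p-1. U k * (of_nat p / (of_nat k - a))) = (\<Sum>k\<le>r. U k * (of_nat p / (of_nat k - a)))"
    using r2p U_large by (intro sum.mono_neutral_right) auto
  \<comment> \<open>The replacement is not valid at k = r, so the contribution \<open>U r\<close> *
    (-1/t) = s B/t is taken out of the closed form.\<close>
  with R Ur pa have rest: "(\<Sum>k\<in>{0..p-1}-{r}. U k * (of_nat p / (of_nat k - a)))
      = s * B * (E y * (1 / D y)) * (1 / t) - s * B * (1 / t)"
    unfolding split[of "\<lambda>k. U k * (of_nat p / (of_nat k - a))"] by simp

  have DE: "p_cong p (D y * E y) (1 + of_nat p * (t * (H1 + H2))) (p\<^sup>2)"
  proof (rule trans)
    show "p_cong p (D y * E y) ((1 + of_nat p * (t * H1)) * (1 + of_nat p * (t * H2))) (p\<^sup>2)"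
      using D_cong E_cong[OF t] by (intro p_cong_mult[OF p]) (simp_all add: y_def)
    show "p_cong p ((1 + of_nat p * (t * H1)) * (1 + of_nat p * (t * H2)))
        (1 + of_nat p * (t * (H1 + H2))) (p\<^sup>2)"
      using t by (intro p_congI[OF p, of _ "t * H1 * (t * H2)"])
        (simp_all add: algebra_simps power2_eq_square)
  qed
  have ED: "p_cong p (E y * (1 / D y)) (1 + of_nat p * (t * (H2 - H1))) (p\<^sup>2)"
  proof (rule trans)
    show "p_cong p (E y * (1 / D y)) ((1 + of_nat p * (t * H2)) * (1 + of_nat p * (- t * H1))) (p\<^sup>2)"
      using D'_cong E_cong[OF t] by (intro p_cong_mult[OF p]) (simp_all add: y_def)
    show "p_cong p ((1 + of_nat p * (t * H2)) * (1 + of_nat p * (- t * H1)))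
        (1 + of_nat p * (t * (H2 - H1))) (p\<^sup>2)"
      using t by (intro p_congI[OF p, of _ "- (t * H1 * (t * H2))"])
        (simp_all add: algebra_simps power2_eq_square)
  qed

  have S: "p_cong p (\<Sum>k=0..p-1. T k) (s * B * (1 / t + 2 * of_nat p * H2)) (p\<^sup>2)"
  proof (rule trans)
    have sBt: "s * B * (1 / t) \<in> p_integers p"
      by (intro p_integers_mult[OF p] invt) simp_all
    have "p_cong p (T r + (\<Sum>k\<in>{0..p-1}-{r}. T k))
        (s * B * (1 / t) * (1 + of_nat p * (t * (H1 + H2)))
          + (\<Sum>k\<in>{0..p-1}-{r}. U k * (of_nat p / (of_nat k - a)))) (p\<^sup>2)"
    proof (intro p_cong_add[OF p] p_cong_sum[OF p])
      show "p_cong p (T r) (s * B * (1 / t) * (1 + of_nat p * (t * (H1 + H2)))) (p\<^sup>2)"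
        using p_cong_mult[OF p refl[OF sBt] DE] by (simp add: Tr mult_ac)
    qed (rule TU, use p0 in auto)
    then show "p_cong p (\<Sum>k=0..p-1. T k) (s * B * (1 / t) * (1 + of_nat p * (t * (H1 + H2)))
          + (s * B * (1 / t) * (E y * (1 / D y)) - s * B * (1 / t))) (p\<^sup>2)"
      unfolding split[of T] rest by (simp add: mult_ac)
    have "p_cong p (s * B * (1 / t) * (1 + of_nat p * (t * (H1 + H2)))
          + (s * B * (1 / t) * (E y * (1 / D y)) + - (s * B * (1 / t))))
        (s * B * (1 / t) * (1 + of_nat p * (t * (H1 + H2)))
          + (s * B * (1 / t) * (1 + of_nat p * (t * (H2 - H1))) + - (s * B * (1 / t)))) (p\<^sup>2)"
      by (intro p_cong_add[OF p] p_cong_mult[OF p] refl ED sBt p_integers_mult[OF p]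
          p_integers_uminus[OF p]) (use t in simp_all)
    \<comment> \<open>\<open>H1\<close> occurs with opposite signs and cancels, \<open>H2\<close>
      doubles, and the constants add up to 1+1-1.\<close>
    also have "s * B * (1 / t) * (1 + of_nat p * (t * (H1 + H2)))
          + (s * B * (1 / t) * (1 + of_nat p * (t * (H2 - H1))) + - (s * B * (1 / t)))
        = s * B * (1 / t + 2 * of_nat p * H2)"
      using t0 by (simp add: field_simps)
    finally show "p_cong p (s * B * (1 / t) * (1 + of_nat p * (t * (H1 + H2)))
          + (s * B * (1 / t) * (E y * (1 / D y)) - s * B * (1 / t)))
        (s * B * (1 / t + 2 * of_nat p * H2)) (p\<^sup>2)"
      by simp
  qed

  \<comment> \<open>The middle expression\<close>
  \<comment> \<open>Since p-1-r = -1-(r-p), this is the binomial of -1-a with \<open>y\<close>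
    replaced by -p. The argument is written p*(-1) to fit \<open>E_cong\<close>.\<close>
  have C: "of_nat ((p - 1 - r) choose r) = - (s * B * E (of_nat p * (- 1)))"
  proof -
    have "(of_nat (p - 1 - r) :: rat) = of_nat p - 1 - of_nat r"
      using r2p assms(5) by (simp add: of_nat_diff)
    then show ?thesis
      using poch2[of "- of_nat p"]
      by (simp add: binomial_gbinomial gbinomial_pochhammer s algebra_simps)
  qed
  have M: "p_cong p ((2 * t + 1) / t * s * B + 2 * of_nat ((p - 1 - r) choose r))
      (s * B * (1 / t + 2 * of_nat p * H2)) (p\<^sup>2)"
  proof -
    have "p_cong p (s * B * (2 + 1 / t) + (- 2 * s * B) * E (of_nat p * (- 1)))
        (s * B * (2 + 1 / t) + (- 2 * s * B) * (1 + of_nat p * (- 1 * H2))) (p\<^sup>2)"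
      by (intro p_cong_add[OF p] p_cong_mult[OF p] refl E_cong p_integers_mult[OF p]
          p_integers_add[OF p] invt) simp_all
    \<comment> \<open>The 2 from (2t+1)/t = 2 + 1/t cancels the leading term of the second binomial;
      its first-order term supplies 2p\<open>H2\<close>.\<close>
    also have "s * B * (2 + 1 / t) + (- 2 * s * B) * (1 + of_nat p * (- 1 * H2))
        = s * B * (1 / t + 2 * of_nat p * H2)"
      by (simp add: algebra_simps)
    also have "s * B * (2 + 1 / t) + (- 2 * s * B) * E (of_nat p * (- 1))
        = (2 * t + 1) / t * s * B + 2 * of_nat ((p - 1 - r) choose r)"
      unfolding C using t0 by (simp add: field_simps)
    finally show ?thesis .
  qed
  show ?thesis
    \<comment> \<open>The first congruence passes through the harmonic form, to which both other
      expressions are congruent.\<close>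
    using trans[OF S p_cong_sym[OF p M]] M
    by (simp only: T_def s_def B_def harm)
qed

end
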